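(* Let $p,r\ge0$ be integers, $d=p+r$, and let $\Lambda=\{\lambda_1,\dots,\lambda_r\}\subset\mathbb{C}\setminus\{0\}$ consist of $r$ pairwise distinct numbers. For $f\in C^d(\mathbb{R})$ define $$T_{p,\Lambda}f(x,h):=\left[1,h,\dots,h^p,e^{\lambda_1h},\dots,e^{\lambda_rh}\right]V_d^{-1}v_f(x),\qquad x,h\in\mathbb{R}.$$ Then for any $R<1$, $$\left|T_{p,\Lambda}f(x,h)-T_df(x,h)\right|\le C_{\Lambda,R}\,|v_f(x)|_2\,|h|^{d+1},\qquad |h|\le R,\ x\in\mathbb{R},$$ where the constant $C_{\Lambda,R}$ depends on $\Lambda$ and $R$ only.
   Context: $C^d(\mathbb{R})$ is the space of $d$-times continuously differentiable functions $\mathbb{R}\to\mathbb{R}$. For $f\in C^d(\mathbb{R})$, $v_f(x)=[f^{(j)}(x)]_{j=0}^d$ (column vector), $|\cdot|_2$ is the Euclidean norm, and $T_df(x,h)=\sum_{j=0}^d\frac{f^{(j)}(x)}{j!}h^j$ is the usual Taylor operator. $V_d$ is the $(d+1)\times(d+1)$ matrix with rows indexed $k=0,\dots,d$ whose first $p+1$ columns (indexed $j=0,\dots,p$) have the entry $j!$ in row $k=j$ and $0$ elsewhere, and whose last $r$ columns are $[\lambda_i^k]_{k=0}^d$, $i=1,\dots,r$. This matrix is invertible. *)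

theory Defs
  imports
    "HOL-Analysis.Derivative"
    "HOL-Analysis.L2_Norm"
    "Jordan_Normal_Form.Determinant"
begin

text \<open>Both \<^theory>\<open>HOL-Analysis.Finite_Cartesian_Product\<close> and \<^theory>\<open>Jordan_Normal_Form.Matrix\<close>
  use the dollar sign for vector components; only the latter meaning is wanted here.\<close>

unbundle no vec_syntax

definition Cd_space :: "nat \<Rightarrow> (real \<Rightarrow> real) set" where
  "Cd_space d = {f. (\<forall>j<d. \<forall>x. ((deriv ^^ j) f) field_differentiable at x) \<and>
                    continuous_on UNIV ((deriv ^^ d) f)}"

definition deriv_vec :: "nat \<Rightarrow> (real \<Rightarrow> real) \<Rightarrow> real \<Rightarrow> real vec" where
  "deriv_vec d f x = vec (d + 1) (\<lambda>j. (deriv ^^ j) f x)"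

definition euclid_norm :: "real vec \<Rightarrow> real" where
  "euclid_norm v = L2_set (\<lambda>j. v $ j) {..<dim_vec v}"

definition taylor_op :: "nat \<Rightarrow> (real \<Rightarrow> real) \<Rightarrow> real \<Rightarrow> real \<Rightarrow> real" where
  "taylor_op d f x h = (\<Sum>j\<le>d. (deriv ^^ j) f x / fact j * h ^ j)"

text \<open>The frequencies are \<open>lam 1, \<dots>, lam r\<close>; column \<open>j > p\<close> (counted from \<open>0\<close>)
  belongs to \<open>lam (j - p)\<close>. Other values of \<open>lam\<close> are irrelevant.\<close>

definition V_mat :: "nat \<Rightarrow> nat \<Rightarrow> (nat \<Rightarrow> complex) \<Rightarrow> complex mat" where
  "V_mat p r lam = mat (p + r + 1) (p + r + 1)
     (\<lambda>(k, j). if j \<le> p then (if k = j then fact j else 0) else lam (j - p) ^ k)"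

definition basis_vec :: "nat \<Rightarrow> nat \<Rightarrow> (nat \<Rightarrow> complex) \<Rightarrow> real \<Rightarrow> complex vec" where
  "basis_vec p r lam h = vec (p + r + 1)
     (\<lambda>j. if j \<le> p then complex_of_real h ^ j else exp (lam (j - p) * complex_of_real h))"

text \<open>The operation \<open>\<bullet>\<close> on \<open>vec\<close> is bilinear (no conjugation), so it is the product of a row
  with a column. The inverse exists by \<open>V_mat_inverse\<close> below.\<close>

definition exp_taylor_op ::
    "nat \<Rightarrow> nat \<Rightarrow> (nat \<Rightarrow> complex) \<Rightarrow> (real \<Rightarrow> real) \<Rightarrow> real \<Rightarrow> real \<Rightarrow> complex" where
  "exp_taylor_op p r lam f x h =
     basis_vec p r lam h \<bullet>
       (the (mat_inverse (V_mat p r lam)) *\<^sub>v map_vec complex_of_real (deriv_vec (p + r) f x))"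

lemma V_mat_carrier: "V_mat p r lam \<in> carrier_mat (p + r + 1) (p + r + 1)"
  by (simp add: V_mat_def)

lemma det_V_mat_nonzero:
  assumes inj: "inj_on lam {1..r}" and nz: "\<And>i. i \<in> {1..r} \<Longrightarrow> lam i \<noteq> 0"
  shows "det (V_mat p r lam) \<noteq> 0"
proof
  let ?n = "p + r + 1" and ?V = "V_mat p r lam"
  assume "det ?V = 0"
  then have "det (transpose_mat ?V) = 0"
    using det_transpose[OF V_mat_carrier] by metis
  then obtain c where c: "c \<in> carrier_vec ?n" "c \<noteq> 0\<^sub>v ?n" "transpose_mat ?V *\<^sub>v c = 0\<^sub>v ?n"
    using det_0_iff_vec_prod_zero_field[of "transpose_mat ?V" ?n] V_mat_carrier
    by (metis transpose_carrier_mat)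
  have eq: "(\<Sum>k<?n. ?V $$ (k, j) * c $ k) = 0" if "j < ?n" for j
  proof -
    have "(transpose_mat ?V *\<^sub>v c) $ j = 0"
      using that c(3) by simp
    then show ?thesis
      using that c(1) V_mat_carrier[of p r lam]
      by (simp add: scalar_prod_def lessThan_atLeast0)
  qed
  have low: "c $ j = 0" if "j \<le> p" for j
  proof -
    have "(\<Sum>k<?n. ?V $$ (k, j) * c $ k) = (\<Sum>k<?n. if k = j then fact j * c $ k else 0)"
      using that by (intro sum.cong) (auto simp: V_mat_def)
    also have "\<dots> = fact j * c $ j"
      using that by simp
    finally show ?thesis
      using eq[of j] that by simp
  qed
  define q where "q = (\<Sum>k<r. monom (c $ (p + 1 + k)) k)"
  have root: "poly q (lam i) = 0" if i: "i \<in> {1..r}" for i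
  proof -
    have "(\<Sum>k<?n. ?V $$ (k, p + i) * c $ k) = (\<Sum>k<?n. lam i ^ k * c $ k)"
      using i by (intro sum.cong) (auto simp: V_mat_def)
    also have "\<dots> = (\<Sum>k=p+1..<p+1+r. lam i ^ k * c $ k)"
      using low by (intro sum.mono_neutral_right) auto
    also have "\<dots> = (\<Sum>k<r. lam i ^ (p + 1 + k) * c $ (p + 1 + k))"
      using sum.shift_bounds_nat_ivl[of "\<lambda>k. lam i ^ k * c $ k" 0 "p + 1" r]
      by (simp add: lessThan_atLeast0 add_ac)
    also have "\<dots> = lam i ^ (p + 1) * poly q (lam i)"
      by (simp add: q_def poly_sum poly_monom sum_distrib_left power_add mult_ac)
    finally show ?thesis
      using eq[of "p + i"] i nz[OF i] by simp
  qed
  have coeff_q: "coeff q k = (if k < r then c $ (p + 1 + k) else 0)" for k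
    by (auto simp: q_def coeff_sum)
  have "q = 0"
  proof (rule ccontr)
    assume q: "q \<noteq> 0"
    have "degree q < r"
      using coeff_q[of "degree q"] q by (auto split: if_splits)
    moreover have "r = card (lam ` {1..r})"
      using inj by (simp add: card_image)
    moreover have "card (lam ` {1..r}) \<le> card {x. poly q x = 0}"
      using root q by (intro card_mono) (auto simp: poly_roots_finite)
    moreover have "card {x. poly q x = 0} \<le> degree q"
      using q by (rule card_poly_roots_bound)
    ultimately show False by simp
  qed
  have "c $ k = 0" if "k < ?n" for k
  proof (cases "k \<le> p")
    case False
    then obtain m where "k = p + 1 + m"
      using le_Suc_ex[of "p + 1" k] by auto
    then show ?thesis
      using coeff_q[of m] \<open>q = 0\<close> that by simp
  qed (use low in simp)
  then have "c = 0\<^sub>v ?n"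
    using c(1) by (intro eq_vecI) auto
  with c(2) show False by simp
qed

lemma V_mat_inverse:
  assumes "inj_on lam {1..r}" and "\<And>i. i \<in> {1..r} \<Longrightarrow> lam i \<noteq> 0"
  shows "the (mat_inverse (V_mat p r lam)) \<in> carrier_mat (p + r + 1) (p + r + 1)"
    and "V_mat p r lam * the (mat_inverse (V_mat p r lam)) = 1\<^sub>m (p + r + 1)"
    and "the (mat_inverse (V_mat p r lam)) * V_mat p r lam = 1\<^sub>m (p + r + 1)"
proof -
  have "det (V_mat p r lam) \<noteq> 0"
    using assms by (rule det_V_mat_nonzero)
  then have "mat_inverse (V_mat p r lam) \<noteq> None"
    using det_non_zero_imp_unit[OF V_mat_carrier[of p r lam]]
      mat_inverse(1)[OF V_mat_carrier[of p r lam]] by metis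
  then obtain B where "mat_inverse (V_mat p r lam) = Some B" by blast
  with mat_inverse(2)[OF V_mat_carrier this]
  show "the (mat_inverse (V_mat p r lam)) \<in> carrier_mat (p + r + 1) (p + r + 1)"
    and "V_mat p r lam * the (mat_inverse (V_mat p r lam)) = 1\<^sub>m (p + r + 1)"
    and "the (mat_inverse (V_mat p r lam)) * V_mat p r lam = 1\<^sub>m (p + r + 1)"
    by simp_all
qed

end

theory Submission
  imports Defs "HOL-Analysis.Complex_Transcendental"
begin

unbundle no vec_syntax

text \<open>
  Let \<open>w = V\<^sub>d\<^sup>-\<^sup>1 v\<^sub>f(x)\<close>. Writing \<open>T\<^sub>d f\<close> as the row \<open>(h\<^sup>k / k!)\<^sub>k\<close> times \<open>V\<^sub>d w\<close>, the polynomial columns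
  cancel and the error becomes the sum over \<open>i\<close> of \<open>w\<^sub>p\<^sub>+\<^sub>i\<close> times the remainder of order \<open>d + 1\<close> of the
  exponential series at \<open>\<lambda>\<^sub>i h\<close>. The rows \<open>k > p\<close> of \<open>V\<^sub>d w = v\<^sub>f(x)\<close> form a Vandermonde system for
  \<open>\<lambda>\<^sub>i\<^sup>p\<^sup>+\<^sup>1 w\<^sub>p\<^sub>+\<^sub>i\<close>, which the Lagrange polynomials of \<open>\<Lambda>\<close> solve. Of the factor \<open>|\<lambda>\<^sub>i|\<^sup>d\<^sup>+\<^sup>1\<close> in the
  remainder only \<open>|\<lambda>\<^sub>i|\<^sup>r\<close> survives, so that the constant does not depend on \<open>p\<close>.
\<close>

text \<open>The product runs over a set rather than an enumeration, so the coefficients depend only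
  on the nodes and not on their order.\<close>

definition lagrange_basis :: "'a::field set \<Rightarrow> 'a \<Rightarrow> 'a poly" where
  "lagrange_basis A a = (\<Prod>b\<in>A - {a}. smult (1 / (a - b)) [:- b, 1:])"

lemma poly_lagrange_basis:
  assumes "finite A" and "b \<in> A"
  shows "poly (lagrange_basis A a) b = (if b = a then 1 else 0)"
proof (cases "b = a")
  case True
  then show ?thesis
    by (auto simp: lagrange_basis_def poly_prod diff_divide_distrib[symmetric]
        intro!: prod.neutral split: if_splits)
next
  case False
  then show ?thesis
    using assms by (auto simp: lagrange_basis_def poly_prod intro!: prod_zero bexI[of _ b])
qed

text \<open>There are \<open>card A - 1\<close> factors, each of degree at most 1. The strict bound
  lets a sum over \<open>m < card A\<close> capture every coefficient.\<close>

lemma degree_lagrange_basis_less: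
  assumes "finite A" and "a \<in> A"
  shows "degree (lagrange_basis A a) < card A"
proof -
  have "degree (lagrange_basis A a) \<le> (\<Sum>b\<in>A - {a}. degree (smult (1 / (a - b)) [:- b, 1:]))"
    unfolding lagrange_basis_def
    using degree_prod_sum_le[of "A - {a}" "\<lambda>b. smult (1 / (a - b)) [:- b, 1:]"] assms(1)
    by (simp only: o_def finite_Diff)
  also have "\<dots> \<le> (\<Sum>b\<in>A - {a}. 1)"
    by (intro sum_mono) simp
  also have "\<dots> = card A - 1"
    using assms by simp
  also have "\<dots> < card A"
    using assms by (auto simp: card_gt_0_iff intro!: diff_less)
  finally show ?thesis .
qed

lemma sum_coeff_mult_power:
  fixes q :: "'a::comm_semiring_1 poly"
  assumes "degree q < n"
  shows "(\<Sum>m<n. coeff q m * a ^ m) = poly q a"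
  unfolding poly_altdef using assms
  by (intro sum.mono_neutral_right) (auto simp: coeff_eq_0)

text \<open>Weighting the moments with the coefficients of a polynomial of degree below
  \<open>r\<close> evaluates it at the nodes. The Lagrange polynomial of \<open>lam i\<close>
  vanishes at all other nodes, so only \<open>u i\<close> remains. This is an explicit inverse of
  the Vandermonde system.\<close>

lemma lagrange_solves_moments:
  fixes lam :: "nat \<Rightarrow> 'a::field"
  assumes lam: "bij_betw lam I A" and A: "finite A" "card A = r" and i: "i \<in> I"
    and moments: "\<And>m. m < r \<Longrightarrow> (\<Sum>j\<in>I. lam j ^ m * u j) = s m"
  shows "u i = (\<Sum>m<r. coeff (lagrange_basis A (lam i)) m * s m)"
proof -
  let ?L = "lagrange_basis A (lam i)"
  have I: "finite I"
    using lam A by (simp add: bij_betw_finite)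
  have lamA: "lam j \<in> A" if "j \<in> I" for j
    using lam that by (auto simp: bij_betw_def)
  have "(\<Sum>m<r. coeff ?L m * s m) = (\<Sum>m<r. \<Sum>j\<in>I. coeff ?L m * (lam j ^ m * u j))"
    by (intro sum.cong) (simp_all add: moments[symmetric] sum_distrib_left)
  also have "\<dots> = (\<Sum>j\<in>I. (\<Sum>m<r. coeff ?L m * lam j ^ m) * u j)"
    by (subst sum.swap) (simp add: sum_distrib_right mult.assoc)
  also have "\<dots> = (\<Sum>j\<in>I. poly ?L (lam j) * u j)"
    using degree_lagrange_basis_less[OF A(1) lamA[OF i]] A(2)
    by (simp add: sum_coeff_mult_power)
  also have "\<dots> = (\<Sum>j\<in>I. if j = i then u j else 0)"
    using lam i lamA A(1) by (intro sum.cong) (auto simp: poly_lagrange_basis bij_betw_def inj_on_def)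
  also have "\<dots> = u i"
    using I i by simp
  finally show ?thesis by simp
qed

text \<open>The factor \<open>1 / fact n\<close> of the Taylor bound is given up, which leaves a
  constant free of \<open>n\<close>; in the application \<open>n = p + r\<close>.\<close>

lemma exp_remainder_le:
  fixes z :: complex
  assumes "cmod z \<le> B"
  shows "cmod (exp z - (\<Sum>k\<le>n. z ^ k / fact k)) \<le> exp B * cmod z ^ (n + 1)"
proof -
  have "cmod (exp z - (\<Sum>k\<le>n. z ^ k / fact k)) \<le> exp \<bar>Re z\<bar> * cmod z ^ Suc n / fact n"
    by (rule Taylor_exp)
  also have "\<dots> \<le> exp \<bar>Re z\<bar> * cmod z ^ Suc n"
    using divide_left_mono[of 1 "fact n" "exp \<bar>Re z\<bar> * cmod z ^ Suc n"] fact_ge_1[of n] by simp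
  also have "\<dots> \<le> exp B * cmod z ^ Suc n"
    using abs_Re_le_cmod[of z] assms by (intro mult_right_mono) auto
  finally show ?thesis by simp
qed

lemma abs_index_le_euclid_norm: "k < dim_vec v \<Longrightarrow> \<bar>v $ k\<bar> \<le> euclid_norm v"
  using member_le_L2_set[of "{..<dim_vec v}" k "\<lambda>j. \<bar>v $ j\<bar>"]
  by (simp add: euclid_norm_def L2_set_def)

text \<open>A polynomial column has its only nonzero entry in a row with index at most
  \<open>p\<close>, so it contributes nothing to the rows below.\<close>

lemma V_mat_exponential_columns:
  fixes w :: "nat \<Rightarrow> complex"
  assumes "p < k" and "k < p + r + 1"
  shows "(\<Sum>j<p + r + 1. V_mat p r lam $$ (k, j) * w j) = (\<Sum>i\<in>{1..r}. lam i ^ k * w (p + i))"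
proof -
  have "(\<Sum>j<p + r + 1. V_mat p r lam $$ (k, j) * w j) = (\<Sum>j=1+p..r+p. lam (j - p) ^ k * w j)"
    using assms by (intro sum.mono_neutral_cong_right) (auto simp: V_mat_def)
  also have "\<dots> = (\<Sum>i\<in>{1..r}. lam i ^ k * w (p + i))"
    by (simp only: sum.shift_bounds_cl_nat_ivl) (simp add: add.commute)
  finally show ?thesis .
qed

text \<open>A single \<open>w\<close>, independent of \<open>h\<close>, serves both facts: it
  consists of the last \<open>r\<close> entries of the inverse matrix applied to the derivative
  vector.\<close>

lemma exp_taylor_op_minus_taylor_op:
  fixes lam :: "nat \<Rightarrow> complex" and f :: "real \<Rightarrow> real"
  assumes inj: "inj_on lam {1..r}" and nz: "\<And>i. i \<in> {1..r} \<Longrightarrow> lam i \<noteq> 0"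
  obtains w where
    "\<And>h. exp_taylor_op p r lam f x h - complex_of_real (taylor_op (p + r) f x h) =
       (\<Sum>i\<in>{1..r}. (exp (lam i * of_real h) - (\<Sum>k\<le>p + r. (lam i * of_real h) ^ k / fact k)) * w i)"
    and "\<And>k. p < k \<Longrightarrow> k < p + r + 1 \<Longrightarrow>
       (\<Sum>i\<in>{1..r}. lam i ^ k * w i) = complex_of_real ((deriv ^^ k) f x)"
proof -
  let ?n = "p + r + 1" and ?V = "V_mat p r lam"
  define v where "v = map_vec complex_of_real (deriv_vec (p + r) f x)"
  define w where "w = the (mat_inverse ?V) *\<^sub>v v"
  note inv = V_mat_inverse[of lam r p, OF inj nz]
  have v: "v \<in> carrier_vec ?n"
    by (simp add: v_def deriv_vec_def)
  have w: "w \<in> carrier_vec ?n"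
    using inv(1) v by (simp add: w_def)
  have Vw_eq: "?V *\<^sub>v w = v"
    unfolding w_def
    using assoc_mult_mat_vec[OF V_mat_carrier[of p r lam] inv(1) v, symmetric] inv(2) v by simp
  have Vw: "(\<Sum>j<?n. ?V $$ (k, j) * w $ j) = complex_of_real ((deriv ^^ k) f x)"
    if "k < ?n" for k
  proof -
    have "(\<Sum>j<?n. ?V $$ (k, j) * w $ j) = (?V *\<^sub>v w) $ k"
      using that w V_mat_carrier[of p r lam] by (simp add: scalar_prod_def lessThan_atLeast0)
    also have "\<dots> = complex_of_real ((deriv ^^ k) f x)"
      using that Vw_eq by (simp add: v_def deriv_vec_def)
    finally show ?thesis .
  qed
  have 1: "exp_taylor_op p r lam f x h - complex_of_real (taylor_op (p + r) f x h) =
       (\<Sum>i\<in>{1..r}. (exp (lam i * of_real h) - (\<Sum>k\<le>p + r. (lam i * of_real h) ^ k / fact k)) * w $ (p + i))"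
    (is "_ = ?rhs") for h
  proof -
    let ?b = "basis_vec p r lam h" and ?t = "\<lambda>k. complex_of_real h ^ k / fact k"
    \<comment> \<open>Column \<open>j\<close> of \<open>?V\<close> holds the derivatives at 0 of the
      \<open>j\<close>-th basis function, so \<open>e j\<close> is the Taylor remainder of that
      function at 0.\<close>
    define e where "e j = ?b $ j - (\<Sum>k<?n. ?t k * ?V $$ (k, j))" for j
    have "complex_of_real (taylor_op (p + r) f x h) = (\<Sum>k<?n. ?t k * complex_of_real ((deriv ^^ k) f x))"
      by (simp add: taylor_op_def lessThan_Suc_atMost mult.commute)
    also have "\<dots> = (\<Sum>k<?n. ?t k * (\<Sum>j<?n. ?V $$ (k, j) * w $ j))"
      by (rule sum.cong) (simp_all only: Vw lessThan_iff)
    also have "\<dots> = (\<Sum>j<?n. (\<Sum>k<?n. ?t k * ?V $$ (k, j)) * w $ j)"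
      unfolding sum_distrib_left sum_distrib_right by (subst sum.swap) (simp only: mult.assoc)
    finally have "exp_taylor_op p r lam f x h - complex_of_real (taylor_op (p + r) f x h)
        = (\<Sum>j<?n. e j * w $ j)"
      using w unfolding e_def left_diff_distrib sum_subtractf
      by (simp add: exp_taylor_op_def w_def[symmetric] v_def[symmetric] scalar_prod_def lessThan_atLeast0)
    \<comment> \<open>The monomials of degree at most \<open>p\<close> equal their Taylor
      polynomials, hence have remainder 0.\<close>
    also have "\<dots> = (\<Sum>j=1+p..r+p. e j * w $ j)"
    proof (intro sum.mono_neutral_right ballI)
      fix j assume "j \<in> {..<?n} - {1+p..r+p}"
      then have j: "j \<le> p" by auto
      have "(\<Sum>k<?n. ?t k * ?V $$ (k, j)) = (\<Sum>k<?n. if k = j then of_real h ^ k else 0)"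
        using j by (intro sum.cong) (auto simp: V_mat_def)
      also have "\<dots> = of_real h ^ j"
        using j by simp
      finally show "e j * w $ j = 0"
        using j by (simp add: e_def basis_vec_def)
    qed auto
    also have "\<dots> = (\<Sum>i\<in>{1..r}. e (p + i) * w $ (p + i))"
      by (simp only: sum.shift_bounds_cl_nat_ivl) (simp add: add.commute)
    also have "\<dots> = ?rhs"
    proof (intro sum.cong arg_cong2[where f = "(*)"] refl)
      fix i assume i: "i \<in> {1..r}"
      have "(\<Sum>k<?n. ?t k * ?V $$ (k, p + i)) = (\<Sum>k\<le>p + r. (lam i * of_real h) ^ k / fact k)"
        using i by (intro sum.cong) (auto simp: V_mat_def power_mult_distrib)
      then show "e (p + i) = exp (lam i * of_real h) - (\<Sum>k\<le>p + r. (lam i * of_real h) ^ k / fact k)"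
        using i by (simp add: e_def basis_vec_def)
    qed
    finally show ?thesis .
  qed
  have 2: "(\<Sum>i\<in>{1..r}. lam i ^ k * w $ (p + i)) = complex_of_real ((deriv ^^ k) f x)"
    if "p < k" "k < ?n" for k
    using V_mat_exponential_columns[OF that, of lam "\<lambda>j. w $ j"] Vw[OF that(2)] by simp
  show ?thesis
    by (rule that[of "\<lambda>i. w $ (p + i)"]) (use 1 2 in auto)
qed

theorem lemma5:
  fixes \<Lambda> :: "complex set" and r :: nat and R :: real
  assumes "finite \<Lambda>" and "card \<Lambda> = r" and "0 \<notin> \<Lambda>" and "R < 1"
  shows "\<exists>C::real. \<forall>(p::nat) (lam::nat \<Rightarrow> complex) (f::real \<Rightarrow> real) (x::real) (h::real).
           bij_betw lam {1..r} \<Lambda> \<longrightarrow> f \<in> Cd_space (p + r) \<longrightarrow> \<bar>h\<bar> \<le> R \<longrightarrow>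
           cmod (exp_taylor_op p r lam f x h - complex_of_real (taylor_op (p + r) f x h))
             \<le> C * euclid_norm (deriv_vec (p + r) f x) * \<bar>h\<bar> ^ (p + r + 1)"
proof (intro exI allI impI)
  \<comment> \<open>\<open>?K a\<close> bounds the solution of the Vandermonde system. Summing over
    \<open>\<Lambda>\<close> itself keeps \<open>?C\<close> independent of the enumeration
    \<open>lam\<close>.\<close>
  let ?K = "\<lambda>a. \<Sum>m<r. cmod (coeff (lagrange_basis \<Lambda> a) m)"
  let ?C = "\<Sum>a\<in>\<Lambda>. exp (cmod a * R) * cmod a ^ r * ?K a"
  fix p lam f x and h :: real
  assume lam: "bij_betw lam {1..r} \<Lambda>" and h: "\<bar>h\<bar> \<le> R"
  let ?N = "euclid_norm (deriv_vec (p + r) f x)"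
  let ?rem = "\<lambda>i. exp (lam i * of_real h) - (\<Sum>k\<le>p + r. (lam i * of_real h) ^ k / fact k)"
  have nz: "lam i \<noteq> 0" if "i \<in> {1..r}" for i
    using lam that assms(3) by (auto simp: bij_betw_def)
  obtain w where
    error: "\<And>h. exp_taylor_op p r lam f x h - complex_of_real (taylor_op (p + r) f x h) =
       (\<Sum>i\<in>{1..r}. (exp (lam i * of_real h) - (\<Sum>k\<le>p + r. (lam i * of_real h) ^ k / fact k)) * w i)"
    and moments: "\<And>k. p < k \<Longrightarrow> k < p + r + 1 \<Longrightarrow>
       (\<Sum>i\<in>{1..r}. lam i ^ k * w i) = complex_of_real ((deriv ^^ k) f x)"
    using exp_taylor_op_minus_taylor_op[OF bij_betw_imp_inj_on[OF lam] nz] by blast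
  have w: "cmod (lam i) ^ (p + 1) * cmod (w i) \<le> ?K (lam i) * ?N" if i: "i \<in> {1..r}" for i
  proof -
    let ?s = "\<lambda>m. complex_of_real ((deriv ^^ (p + 1 + m)) f x)"
    \<comment> \<open>The available rows are \<open>p + 1\<close> to \<open>p + r\<close>. Moving
      \<open>lam i ^ (p + 1)\<close> into the unknown turns them into the moments of order
      \<open>m < r\<close>.\<close>
    have "lam i ^ (p + 1) * w i = (\<Sum>m<r. coeff (lagrange_basis \<Lambda> (lam i)) m * ?s m)"
    proof (rule lagrange_solves_moments[OF lam assms(1,2) i])
      fix m assume "m < r"
      then show "(\<Sum>j\<in>{1..r}. lam j ^ m * (lam j ^ (p + 1) * w j)) = ?s m"
        using moments[of "p + 1 + m"] by (simp add: power_add mult_ac)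
    qed
    then have "cmod (lam i) ^ (p + 1) * cmod (w i)
        = cmod (\<Sum>m<r. coeff (lagrange_basis \<Lambda> (lam i)) m * ?s m)"
      by (metis norm_mult norm_power)
    also have "\<dots> \<le> (\<Sum>m<r. cmod (coeff (lagrange_basis \<Lambda> (lam i)) m) * ?N)"
    proof (rule sum_norm_le)
      fix m assume "m \<in> {..<r}"
      then have "cmod (?s m) \<le> ?N"
        using abs_index_le_euclid_norm[of "p + 1 + m" "deriv_vec (p + r) f x"]
        by (simp add: deriv_vec_def)
      then show "cmod (coeff (lagrange_basis \<Lambda> (lam i)) m * ?s m)
          \<le> cmod (coeff (lagrange_basis \<Lambda> (lam i)) m) * ?N"
        unfolding norm_mult by (intro mult_left_mono) auto
    qed
    finally show ?thesis by (simp add: sum_distrib_right)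
  qed
  have term_le: "cmod (?rem i * w i)
      \<le> exp (cmod (lam i) * R) * cmod (lam i) ^ r * ?K (lam i) * ?N * \<bar>h\<bar> ^ (p + r + 1)"
    if i: "i \<in> {1..r}" for i
  proof -
    have "cmod (lam i * of_real h) \<le> cmod (lam i) * R"
      using h by (simp add: norm_mult mult_left_mono)
    then have "cmod (?rem i) * cmod (w i)
        \<le> exp (cmod (lam i) * R) * cmod (lam i * of_real h) ^ (p + r + 1) * cmod (w i)"
      by (intro mult_right_mono exp_remainder_le) auto
    \<comment> \<open>The power \<open>p + r + 1\<close> of \<open>cmod (lam i)\<close> is split:
      \<open>p + 1\<close> factors are absorbed by the bound on \<open>w i\<close>, and
      \<open>r\<close> factors go into the constant.\<close>
    also have "\<dots> = exp (cmod (lam i) * R) * cmod (lam i) ^ r * \<bar>h\<bar> ^ (p + r + 1)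
        * (cmod (lam i) ^ (p + 1) * cmod (w i))"
      by (simp add: norm_mult power_mult_distrib power_add mult_ac)
    also have "\<dots> \<le> exp (cmod (lam i) * R) * cmod (lam i) ^ r * \<bar>h\<bar> ^ (p + r + 1)
        * (?K (lam i) * ?N)"
      by (intro mult_left_mono w i) auto
    finally show ?thesis
      by (simp add: norm_mult mult_ac)
  qed
  have "cmod (exp_taylor_op p r lam f x h - complex_of_real (taylor_op (p + r) f x h))
      \<le> (\<Sum>i\<in>{1..r}. exp (cmod (lam i) * R) * cmod (lam i) ^ r * ?K (lam i) * ?N * \<bar>h\<bar> ^ (p + r + 1))"
    unfolding error by (rule sum_norm_le) (rule term_le)
  also have "\<dots> = ?C * ?N * \<bar>h\<bar> ^ (p + r + 1)"
    unfolding sum_distrib_right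
    by (rule sum.reindex_bij_betw[OF lam,
      of "\<lambda>a. exp (cmod a * R) * cmod a ^ r * ?K a * ?N * \<bar>h\<bar> ^ (p + r + 1)"])
  finally show "cmod (exp_taylor_op p r lam f x h - complex_of_real (taylor_op (p + r) f x h))
      \<le> ?C * ?N * \<bar>h\<bar> ^ (p + r + 1)" .
qed

end
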